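(* Let $r,m$ be positive integers with $\gcd(r,m)=1$ and $G=\mathbf{Z}_r\times\mathbf{Z}_m$. (a) Suppose $f:G\to\mathbf{C}$ is a nonzero function satisfying \[|\mathrm{supp}(f)\cap G_k|+|\mathrm{supp}(\widehat f)\cap\widehat G_k|\le m\quad\text{for all }k=0,1,\dots,r-1. \tag{$*$}\] If $I\subseteq G$ and $J\subseteq\widehat G$ satisfy \[|I\cap G_k|=|J\cap\widehat G_k|\quad\text{for all }k=0,1,\dots,r-1, \tag{$**$}\] with $\mathrm{supp}(f)\subseteq I$ and $\widehat f|_J=0$, then the matrix $(\zeta_{rm}^{ji})_{i\in I,\,j\in J}$ is singular. Moreover, for each such $f$ there exists at least one such pair $I,J$. (b) Conversely, if $I\subseteq G$ and $J\subseteq\widehat G$ satisfy $( ** )$ and the matrix $(\zeta_{rm}^{ji})_{i\in I,\,j\in J}$ is singular, then there exists a nonzero $f:G\to\mathbf{C}$ with $\mathrm{supp}(f)\subseteq I$ and $\widehat f|_J=0$ satisfying $( * )$.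
   Context: Identify $G=\mathbf{Z}_r\times\mathbf{Z}_m$ with $\mathbf{Z}_{rm}$ via $(i_r,i_m)\mapsto i\equiv i_r m+i_m r\pmod{rm}$, and identify the dual group $\widehat G$ likewise with $\mathbf{Z}_r\times\mathbf{Z}_m\cong\mathbf{Z}_{rm}$. Fix a primitive $rm$-th root of unity $\zeta_{rm}$; the Fourier transform of $g:G\to\mathbf{C}$ is $\widehat g(j)=\sum_{i\in\mathbf{Z}_{rm}}g(i)\zeta_{rm}^{ij}$. For $k=0,\dots,r-1$, $G_k=\widehat G_k=\{k\}\times\mathbf{Z}_m$. $\mathrm{supp}$ denotes the set where a function is nonzero. (Condition $( ** )$ forces $|I|=|J|$.) *)

theory Defs
  imports Complex_Main "HOL-Number_Theory.Cong" "Jordan_Normal_Form.DL_Submatrix"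
    "Jordan_Normal_Form.Determinant"
begin

text \<open>\<open>Z_n\<close> is represented by its residues \<open>{..<n}\<close>. The group \<open>Z_r \<times> Z_m\<close> and its dual
  have the same underlying set, both being identified with \<open>Z_{rm}\<close> through \<open>crt_index\<close>.
  A function on the group is a function on pairs of which only the values on \<open>grp r m\<close> matter.\<close>

definition grp :: "nat \<Rightarrow> nat \<Rightarrow> (nat \<times> nat) set" where
  "grp r m = {..<r} \<times> {..<m}"

definition slice :: "nat \<Rightarrow> nat \<Rightarrow> (nat \<times> nat) set" where
  "slice m k = {k} \<times> {..<m}"

definition crt_index :: "nat \<Rightarrow> nat \<Rightarrow> nat \<times> nat \<Rightarrow> nat" where
  "crt_index r m x = (fst x * m + snd x * r) mod (r * m)"

definition is_primitive_root_of_unity :: "nat \<Rightarrow> complex \<Rightarrow> bool" where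
  "is_primitive_root_of_unity n z \<longleftrightarrow> z ^ n = 1 \<and> (\<forall>k. 0 < k \<and> k < n \<longrightarrow> z ^ k \<noteq> 1)"

definition supp :: "nat \<Rightarrow> nat \<Rightarrow> (nat \<times> nat \<Rightarrow> complex) \<Rightarrow> (nat \<times> nat) set" where
  "supp r m g = {x \<in> grp r m. g x \<noteq> 0}"

definition fourier ::
  "nat \<Rightarrow> nat \<Rightarrow> complex \<Rightarrow> (nat \<times> nat \<Rightarrow> complex) \<Rightarrow> nat \<times> nat \<Rightarrow> complex" where
  "fourier r m \<zeta> g y = (\<Sum>x\<in>grp r m. g x * \<zeta> ^ (crt_index r m x * crt_index r m y))"

definition fourier_matrix :: "nat \<Rightarrow> complex \<Rightarrow> complex mat" where
  "fourier_matrix n \<zeta> = mat n n (\<lambda>(i, j). \<zeta> ^ (j * i))"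

text \<open>Rows and columns are listed in increasing order of their index in \<open>{..<r * m}\<close>;
  another enumeration would change the determinant at most by a sign.\<close>

definition fourier_submatrix ::
  "nat \<Rightarrow> nat \<Rightarrow> complex \<Rightarrow> (nat \<times> nat) set \<Rightarrow> (nat \<times> nat) set \<Rightarrow> complex mat" where
  "fourier_submatrix r m \<zeta> I J =
     submatrix (fourier_matrix (r * m) \<zeta>) (crt_index r m ` I) (crt_index r m ` J)"

text \<open>Only meaningful for square matrices: the determinant of a non-square matrix is \<open>0\<close>
  by convention.\<close>

definition singular_mat :: "complex mat \<Rightarrow> bool" where
  "singular_mat A \<longleftrightarrow> det A = 0"

definition support_condition ::
  "nat \<Rightarrow> nat \<Rightarrow> complex \<Rightarrow> (nat \<times> nat \<Rightarrow> complex) \<Rightarrow> bool" where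
  "support_condition r m \<zeta> f \<longleftrightarrow>
     (\<forall>k<r. card (supp r m f \<inter> slice m k) + card (supp r m (fourier r m \<zeta> f) \<inter> slice m k) \<le> m)"

definition same_slice_cards ::
  "nat \<Rightarrow> nat \<Rightarrow> (nat \<times> nat) set \<Rightarrow> (nat \<times> nat) set \<Rightarrow> bool" where
  "same_slice_cards r m I J \<longleftrightarrow> (\<forall>k<r. card (I \<inter> slice m k) = card (J \<inter> slice m k))"

lemma crt_index_bij_betw:
  assumes "0 < r" "0 < m" "coprime r m"
  shows "bij_betw (crt_index r m) (grp r m) {..<r * m}"
proof -
  have inj: "inj_on (crt_index r m) (grp r m)"
  proof (rule inj_onI, clarsimp simp: grp_def)
    fix a b a' b' assume *: "a < r" "b < m" "a' < r" "b' < m"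
      and "crt_index r m (a, b) = crt_index r m (a', b')"
    then have c: "[a * m + b * r = a' * m + b' * r] (mod r * m)"
      by (simp add: crt_index_def cong_def)
    have "[a * m + b * r = a' * m + b' * r] (mod r)"
      using c cong_modulus_mult_nat by blast
    then have "[a * m = a' * m] (mod r)" by (simp add: cong_def)
    then have "[a = a'] (mod r)"
      using assms(3) cong_mult_rcancel_nat coprime_commute by blast
    moreover have "[a * m + b * r = a' * m + b' * r] (mod m)"
      using c cong_modulus_mult_nat by (metis mult.commute)
    then have "[b * r = b' * r] (mod m)" by (simp add: cong_def)
    then have "[b = b'] (mod m)"
      using assms(3) cong_mult_rcancel_nat by blast
    ultimately show "a = a' \<and> b = b'" using * by (simp add: cong_def)
  qed
  have "crt_index r m ` grp r m \<subseteq> {..<r * m}"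
    using assms by (auto simp: crt_index_def)
  moreover have "card (crt_index r m ` grp r m) = card {..<r * m}"
    using card_image[OF inj] by (simp add: grp_def)
  ultimately show ?thesis
    using inj by (simp add: bij_betw_def card_subset_eq)
qed

lemma fourier_eq_sum_residues:
  assumes "0 < r" "0 < m" "coprime r m"
  shows "fourier r m \<zeta> g y =
    (\<Sum>i<r * m. g (inv_into (grp r m) (crt_index r m) i) * \<zeta> ^ (i * crt_index r m y))"
proof -
  note b = crt_index_bij_betw[OF assms]
  have "inj_on (crt_index r m) (grp r m)" using b by (simp add: bij_betw_def)
  then show ?thesis
    unfolding fourier_def
    by (subst sum.reindex_bij_betw[OF b, symmetric]) (simp add: inv_into_f_f)
qed

end

theory Submission
  imports Defs
begin

text \<open>A square matrix is singular exactly when its rows satisfy a nontrivial linear relation.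
  For the rows \<open>I\<close> and columns \<open>J\<close> of the Fourier matrix, extending the
  coefficients of such a relation by zero to the whole group gives a nonzero \<open>f\<close>
  supported in \<open>I\<close>, and the relation in column \<open>y\<close> reads
  \<open>fourier r m \<zeta> f y = 0\<close>. So for \<open>card I = card J\<close>, singularity
  means precisely that such an \<open>f\<close> exists with transform vanishing on \<open>J\<close>
  (\<open>singular_fourier_submatrix_iff\<close>, resting on \<open>det_submatrix_eq_0_iff\<close>).

  The support condition is then a count in each slice, which has \<open>m\<close> elements. If the
  transform vanishes on \<open>J\<close>, then \<open>J\<close> and the support of the transform are
  disjoint there, and \<open>J\<close> has as many points there as \<open>I\<close>, hence at least
  as many as the support of \<open>f\<close> (\<open>support_condition_if_vanishing\<close>).
  Conversely, the condition leaves the transform enough zeros in each slice to choose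
  \<open>J\<close> matching \<open>I = supp r m f\<close>
  (\<open>support_condition_imp_ex_vanishing_set\<close>).\<close>

section \<open>Singular submatrices and linear relations between rows\<close>

lemma bij_betw_pick:
  assumes "finite S"
  shows "bij_betw (pick S) {..<card S} S"
proof -
  have "inj_on (pick S) {..<card S}"
  proof (rule linorder_inj_onI)
    show "pick S a \<noteq> pick S b" if "a < b" "a \<in> {..<card S}" "b \<in> {..<card S}" for a b
      using pick_mono_le[of b S a] that by simp
  qed auto
  moreover have "pick S ` {..<card S} \<subseteq> S"
    using pick_in_set_le by auto
  ultimately show ?thesis
    using assms by (simp add: bij_betw_def card_image card_subset_eq)
qed

text \<open>A zero determinant amounts to a nonzero vector in the kernel of the transpose. The
  vector is expressed as a function on the original row indices, so that later arguments need not
  mention the enumeration \<open>pick\<close>.\<close>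

lemma det_submatrix_eq_0_iff:
  fixes A :: "'a :: idom mat"
  assumes A: "A \<in> carrier_mat nr nc" and S: "S \<subseteq> {..<nr}" and T: "T \<subseteq> {..<nc}"
    and card: "card S = card T"
  shows "det (submatrix A S T) = 0 \<longleftrightarrow>
    (\<exists>g. (\<exists>i\<in>S. g i \<noteq> 0) \<and> (\<forall>j\<in>T. (\<Sum>i\<in>S. g i * A $$ (i, j)) = 0))"
proof -
  define n where "n = card S"
  define B where "B = submatrix A S T"
  have bS: "bij_betw (pick S) {..<n} S" and bT: "bij_betw (pick T) {..<n} T"
    using bij_betw_pick[of S] bij_betw_pick[of T] finite_subset[OF S] finite_subset[OF T] card
    by (simp_all add: n_def)
  \<comment> \<open>\<open>submatrix\<close> discards indices beyond the dimensions of the matrix;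
    here there are none.\<close>
  have "{i. i < dim_row A \<and> i \<in> S} = S" "{j. j < dim_col A \<and> j \<in> T} = T"
    using A S T by auto
  then have "B = mat n n (\<lambda>(i, j). A $$ (pick S i, pick T j))"
    using card by (simp add: B_def submatrix_def n_def)
  then have B_carrier: "B \<in> carrier_mat n n"
    and B_index: "\<And>i j. i < n \<Longrightarrow> j < n \<Longrightarrow> B $$ (i, j) = A $$ (pick S i, pick T j)"
    by simp_all
  \<comment> \<open>The transpose makes the coefficients belong to rows; \<open>inv_into\<close>
    finds the position of row \<open>i\<close> in the enumeration of \<open>S\<close>.\<close>
  have mult: "(transpose_mat B *\<^sub>v v) $ j = (\<Sum>i\<in>S. v $ inv_into {..<n} (pick S) i * A $$ (i, pick T j))"
    if "v \<in> carrier_vec n" "j < n" for v j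
  proof -
    have "(transpose_mat B *\<^sub>v v) $ j = (\<Sum>i<n. v $ i * A $$ (pick S i, pick T j))"
      using that B_carrier by (auto simp: scalar_prod_def B_index lessThan_atLeast0 mult.commute intro!: sum.cong)
    also have "\<dots> = (\<Sum>i<n. v $ inv_into {..<n} (pick S) (pick S i) * A $$ (pick S i, pick T j))"
      using bS by (intro sum.cong) (auto simp: bij_betw_def)
    also have "\<dots> = (\<Sum>i\<in>S. v $ inv_into {..<n} (pick S) i * A $$ (i, pick T j))"
      by (rule sum.reindex_bij_betw[OF bS])
    finally show ?thesis .
  qed
  have "det B = 0 \<longleftrightarrow> (\<exists>v \<in> carrier_vec n. v \<noteq> 0\<^sub>v n \<and> transpose_mat B *\<^sub>v v = 0\<^sub>v n)"
    using det_0_iff_vec_prod_zero[of "transpose_mat B" n] B_carrier det_transpose[OF B_carrier] by auto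
  also have "\<dots> \<longleftrightarrow> (\<exists>g. (\<exists>i\<in>S. g i \<noteq> 0) \<and> (\<forall>j\<in>T. (\<Sum>i\<in>S. g i * A $$ (i, j)) = 0))"
    (is "?L \<longleftrightarrow> ?R")
  proof
    assume ?L
    then obtain v where v: "v \<in> carrier_vec n" "v \<noteq> 0\<^sub>v n" "transpose_mat B *\<^sub>v v = 0\<^sub>v n"
      by blast
    define g where "g = (\<lambda>i. v $ inv_into {..<n} (pick S) i)"
    obtain k where "k < n" "v $ k \<noteq> 0"
      using v by (metis carrier_vecD eq_vecI index_zero_vec)
    then have "pick S k \<in> S" "g (pick S k) \<noteq> 0"
      using bS by (auto simp: g_def bij_betw_def)
    moreover have "(\<Sum>i\<in>S. g i * A $$ (i, j)) = 0" if "j \<in> T" for j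
    proof -
      obtain l where "l < n" "j = pick T l"
        using \<open>j \<in> T\<close> bT by (auto simp: bij_betw_def)
      then show ?thesis
        using mult[OF v(1), of l] v(3) by (simp add: g_def)
    qed
    ultimately show ?R by blast
  next
    assume ?R
    then obtain g i where i: "i \<in> S" "g i \<noteq> 0"
      and g: "\<And>j. j \<in> T \<Longrightarrow> (\<Sum>i\<in>S. g i * A $$ (i, j)) = 0"
      by blast
    define v where "v = vec n (\<lambda>k. g (pick S k))"
    have v_index: "v $ inv_into {..<n} (pick S) i = g i" if "i \<in> S" for i
      using that bS inv_into_into[of i "pick S" "{..<n}"] f_inv_into_f[of i "pick S" "{..<n}"]
      by (simp add: v_def bij_betw_def)
    have "v \<noteq> 0\<^sub>v n"
    proof
      assume "v = 0\<^sub>v n"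
      then have "v $ inv_into {..<n} (pick S) i = 0"
        using i(1) bS inv_into_into[of i "pick S" "{..<n}"] by (simp add: bij_betw_def)
      then show False
        using i v_index by simp
    qed
    moreover have "transpose_mat B *\<^sub>v v = 0\<^sub>v n"
    proof (rule eq_vecI)
      show "(transpose_mat B *\<^sub>v v) $ j = 0\<^sub>v n $ j" if "j < dim_vec (0\<^sub>v n)" for j
        using that bT mult[of v j] g[of "pick T j"] v_index
        by (auto simp: bij_betw_def v_def)
    qed (use B_carrier in auto)
    moreover have "v \<in> carrier_vec n"
      by (simp add: v_def)
    ultimately show ?L by blast
  qed
  finally show ?thesis by (simp add: B_def)
qed

section \<open>Row relations of the Fourier matrix as functions on the group\<close>

text \<open>Transported along the bijection \<open>crt_index\<close>, a row relation with
  coefficients \<open>f\<close> on \<open>I\<close> is a Fourier sum, because \<open>f\<close>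
  contributes nothing outside its support.\<close>

lemma singular_fourier_submatrix_iff:
  assumes pos: "0 < r" "0 < m" "coprime r m"
    and I: "I \<subseteq> grp r m" and J: "J \<subseteq> grp r m" and card: "card I = card J"
  shows "singular_mat (fourier_submatrix r m \<zeta> I J) \<longleftrightarrow>
    (\<exists>f. (\<exists>x\<in>grp r m. f x \<noteq> 0) \<and> supp r m f \<subseteq> I \<and> (\<forall>y\<in>J. fourier r m \<zeta> f y = 0))"
proof -
  let ?c = "crt_index r m"
  let ?F = "fourier_matrix (r * m) \<zeta>"
  have inj: "inj_on ?c (grp r m)" and im: "?c ` grp r m = {..<r * m}"
    using crt_index_bij_betw[OF pos] by (auto simp: bij_betw_def)
  have sub: "?c ` I \<subseteq> {..<r * m}" "?c ` J \<subseteq> {..<r * m}"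
    using I J im by blast+
  have card': "card (?c ` I) = card (?c ` J)"
    using card card_image inj_on_subset[OF inj I] inj_on_subset[OF inj J] by metis
  have fin: "finite (grp r m)"
    by (simp add: grp_def)
  \<comment> \<open>Agreement of \<open>f\<close> and \<open>g\<close> is required on
    \<open>I\<close> only, so that this serves both directions below.\<close>
  have sum_eq: "(\<Sum>i\<in>?c ` I. g i * ?F $$ (i, ?c y)) = fourier r m \<zeta> f y"
    if "y \<in> J" "supp r m f \<subseteq> I" "\<And>x. x \<in> I \<Longrightarrow> f x = g (?c x)" for f g y
  proof -
    have "(\<Sum>i\<in>?c ` I. g i * ?F $$ (i, ?c y)) = (\<Sum>x\<in>I. g (?c x) * ?F $$ (?c x, ?c y))"
      by (simp add: sum.reindex[OF inj_on_subset[OF inj I]])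
    also have "\<dots> = (\<Sum>x\<in>I. f x * \<zeta> ^ (?c x * ?c y))"
    proof (rule sum.cong[OF refl])
      fix x assume "x \<in> I"
      then have "?c x < r * m" "?c y < r * m"
        using sub \<open>y \<in> J\<close> by blast+
      then show "g (?c x) * ?F $$ (?c x, ?c y) = f x * \<zeta> ^ (?c x * ?c y)"
        using that(3)[OF \<open>x \<in> I\<close>] by (simp add: fourier_matrix_def mult.commute)
    qed
    also have "\<dots> = fourier r m \<zeta> f y"
      unfolding fourier_def using fin I that(2)
      by (intro sum.mono_neutral_left) (auto simp: supp_def)
    finally show ?thesis .
  qed
  have "singular_mat (fourier_submatrix r m \<zeta> I J) \<longleftrightarrow>
    (\<exists>g. (\<exists>i\<in>?c ` I. g i \<noteq> 0) \<and> (\<forall>j\<in>?c ` J. (\<Sum>i\<in>?c ` I. g i * ?F $$ (i, j)) = 0))"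
    unfolding singular_mat_def fourier_submatrix_def
    by (rule det_submatrix_eq_0_iff[OF _ sub card']) (simp add: fourier_matrix_def)
  also have "\<dots> \<longleftrightarrow>
    (\<exists>f. (\<exists>x\<in>grp r m. f x \<noteq> 0) \<and> supp r m f \<subseteq> I \<and> (\<forall>y\<in>J. fourier r m \<zeta> f y = 0))"
    (is "?L \<longleftrightarrow> ?R")
  proof
    assume ?L
    then obtain g x where x: "x \<in> I" "g (?c x) \<noteq> 0"
      and g: "\<forall>j\<in>?c ` J. (\<Sum>i\<in>?c ` I. g i * ?F $$ (i, j)) = 0"
      by blast
    \<comment> \<open>Extension by zero makes the support lie in \<open>I\<close>.\<close>
    define f where "f = (\<lambda>x. if x \<in> I then g (?c x) else 0)"
    have "f x \<noteq> 0" "x \<in> grp r m" "supp r m f \<subseteq> I"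
      using x I by (auto simp: f_def supp_def split: if_splits)
    moreover have "fourier r m \<zeta> f y = 0" if "y \<in> J" for y
      using sum_eq[OF that \<open>supp r m f \<subseteq> I\<close>, of g] g that by (simp add: f_def)
    ultimately show ?R by blast
  next
    assume ?R
    then obtain f x where x: "x \<in> grp r m" "f x \<noteq> 0" and f: "supp r m f \<subseteq> I"
      and zero: "\<forall>y\<in>J. fourier r m \<zeta> f y = 0"
      by blast
    define g where "g = f \<circ> inv_into (grp r m) ?c"
    have g: "f x = g (?c x)" if "x \<in> grp r m" for x
      using inj that by (simp add: g_def)
    \<comment> \<open>The relation must be nontrivial on the rows of \<open>I\<close> themselves,
      and the support hypothesis puts the nonzero value there.\<close>
    have "x \<in> I"
      using x f by (auto simp: supp_def)
    then have "\<exists>i\<in>?c ` I. g i \<noteq> 0"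
      using x g[OF x(1)] by (intro bexI[of _ "?c x"]) auto
    moreover have "(\<Sum>i\<in>?c ` I. g i * ?F $$ (i, ?c y)) = 0" if "y \<in> J" for y
      using sum_eq[OF that f, of g] g I zero that by auto
    ultimately show ?L by blast
  qed
  finally show ?thesis .
qed

section \<open>Counting in slices\<close>

lemma finite_slice: "finite (slice m k)"
  by (simp add: slice_def)

lemma card_slice: "card (slice m k) = m"
  by (simp add: slice_def)

lemma grp_eq_UN_slice: "grp r m = (\<Union>k<r. slice m k)"
  by (auto simp: grp_def slice_def)

text \<open>Distinct slices are disjoint, so sets chosen independently in each slice can be glued
  and recovered.\<close>

lemma slice_inter_UN:
  assumes "k < r" "\<And>l. A l \<subseteq> slice m l"
  shows "(\<Union>l<r. A l) \<inter> slice m k = A k"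
proof (intro equalityI subsetI)
  fix x assume "x \<in> (\<Union>l<r. A l) \<inter> slice m k"
  then obtain l where "x \<in> A l" "x \<in> slice m k"
    by blast
  moreover from this have "l = k"
    using assms(2)[of l] by (auto simp: slice_def)
  ultimately show "x \<in> A k" by simp
qed (use assms in blast)

text \<open>The slices partition the group. This makes the submatrix square, as the determinant
  criterion demands.\<close>

lemma same_slice_cards_imp_card_eq:
  assumes "I \<subseteq> grp r m" "J \<subseteq> grp r m" "same_slice_cards r m I J"
  shows "card I = card J"
proof -
  have "card K = (\<Sum>k<r. card (K \<inter> slice m k))" if "K \<subseteq> grp r m" for K
  proof -
    have "K = (\<Union>k<r. K \<inter> slice m k)"
      using that by (auto simp: grp_eq_UN_slice)
    then have "card K = card (\<Union>k<r. K \<inter> slice m k)"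
      by simp
    also have "\<dots> = (\<Sum>k<r. card (K \<inter> slice m k))"
      by (rule card_UN_disjoint) (auto simp: slice_def)
    finally show ?thesis .
  qed
  then show ?thesis
    using assms by (simp add: same_slice_cards_def)
qed

text \<open>In each slice the transform has \<open>m\<close> minus the size of its support there
  many zeros. By the support condition this is at least the number of support points of
  \<open>f\<close>, so that many zeros can be selected.\<close>

lemma support_condition_imp_ex_vanishing_set:
  assumes "support_condition r m \<zeta> f"
  shows "\<exists>J \<subseteq> grp r m. same_slice_cards r m (supp r m f) J \<and> (\<forall>y\<in>J. fourier r m \<zeta> f y = 0)"
proof -
  let ?Z = "\<lambda>k. slice m k - supp r m (fourier r m \<zeta> f)"
  \<comment> \<open>The value 0 for \<open>k \<ge> r\<close> makes the claim hold for every
    \<open>k\<close>, so that one choice function \<open>A\<close> can be extracted.\<close>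
  have "\<exists>A \<subseteq> ?Z k. card A = (if k < r then card (supp r m f \<inter> slice m k) else 0)" for k
  proof (rule obtain_subset_with_card_n)
    show "(if k < r then card (supp r m f \<inter> slice m k) else 0) \<le> card (?Z k)"
      using assms card_Diff_subset_Int[of "slice m k" "supp r m (fourier r m \<zeta> f)"]
      by (auto simp: support_condition_def card_slice finite_slice Int_commute)
  qed blast
  then obtain A where A: "\<And>k. A k \<subseteq> ?Z k"
    and card_A: "\<And>k. k < r \<Longrightarrow> card (A k) = card (supp r m f \<inter> slice m k)"
    by metis
  define J where "J = (\<Union>k<r. A k)"
  have "J \<inter> slice m k = A k" if "k < r" for k
    unfolding J_def using that A by (intro slice_inter_UN) blast+
  then have "same_slice_cards r m (supp r m f) J"
    by (simp add: same_slice_cards_def card_A)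
  moreover have "J \<subseteq> grp r m" "\<forall>y\<in>J. fourier r m \<zeta> f y = 0"
    using A by (fastforce simp: J_def grp_eq_UN_slice supp_def)+
  ultimately show ?thesis by blast
qed

text \<open>In each slice, \<open>J\<close> and the support of the transform are disjoint and
  together have at most \<open>m\<close> points; the slice of \<open>J\<close> is as large as that
  of \<open>I\<close>, which contains the support of \<open>f\<close>.\<close>

lemma support_condition_if_vanishing:
  assumes "J \<subseteq> grp r m" "same_slice_cards r m I J" "supp r m f \<subseteq> I"
    and "\<forall>y\<in>J. fourier r m \<zeta> f y = 0"
  shows "support_condition r m \<zeta> f"
  unfolding support_condition_def
proof (intro allI impI)
  fix k assume "k < r"
  let ?H = "supp r m (fourier r m \<zeta> f)"
  have "I \<inter> slice m k \<subseteq> slice m k"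
    by blast
  then have "card (supp r m f \<inter> slice m k) \<le> card (I \<inter> slice m k)"
    using assms(3) by (intro card_mono) (auto simp: finite_slice)
  also have "\<dots> = card (J \<inter> slice m k)"
    using assms(2) \<open>k < r\<close> by (simp add: same_slice_cards_def)
  finally have "card (supp r m f \<inter> slice m k) + card (?H \<inter> slice m k)
      \<le> card (J \<inter> slice m k) + card (?H \<inter> slice m k)"
    by simp
  also have "\<dots> = card ((J \<inter> slice m k) \<union> (?H \<inter> slice m k))"
    using assms(4) by (intro card_Un_disjoint[symmetric]) (auto simp: finite_slice supp_def)
  also have "\<dots> \<le> card (slice m k)"
    by (intro card_mono) (auto simp: finite_slice)
  finally show "card (supp r m f \<inter> slice m k) + card (?H \<inter> slice m k) \<le> m"
    by (simp add: card_slice)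
qed

theorem theorem5p1:
  fixes r m :: nat and \<zeta> :: complex
  assumes "0 < r" and "0 < m" and "coprime r m"
    and "is_primitive_root_of_unity (r * m) \<zeta>"
  shows
    "(\<forall>f :: nat \<times> nat \<Rightarrow> complex.
        (\<exists>x\<in>grp r m. f x \<noteq> 0) \<and> support_condition r m \<zeta> f \<longrightarrow>
          (\<forall>I J. I \<subseteq> grp r m \<and> J \<subseteq> grp r m \<and> same_slice_cards r m I J \<and>
             supp r m f \<subseteq> I \<and> (\<forall>y\<in>J. fourier r m \<zeta> f y = 0) \<longrightarrow>
             singular_mat (fourier_submatrix r m \<zeta> I J)) \<and>
          (\<exists>I J. I \<subseteq> grp r m \<and> J \<subseteq> grp r m \<and> same_slice_cards r m I J \<and>
             supp r m f \<subseteq> I \<and> (\<forall>y\<in>J. fourier r m \<zeta> f y = 0))) \<and>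
     (\<forall>I J. I \<subseteq> grp r m \<and> J \<subseteq> grp r m \<and> same_slice_cards r m I J \<and>
        singular_mat (fourier_submatrix r m \<zeta> I J) \<longrightarrow>
        (\<exists>f :: nat \<times> nat \<Rightarrow> complex.
           (\<exists>x\<in>grp r m. f x \<noteq> 0) \<and> supp r m f \<subseteq> I \<and>
           (\<forall>y\<in>J. fourier r m \<zeta> f y = 0) \<and> support_condition r m \<zeta> f))"
proof (intro conjI allI impI; elim conjE)
  note sing_iff = singular_fourier_submatrix_iff[OF assms(1-3) _ _ same_slice_cards_imp_card_eq]
  show "singular_mat (fourier_submatrix r m \<zeta> I J)"
    if "\<exists>x\<in>grp r m. f x \<noteq> 0" "I \<subseteq> grp r m" "J \<subseteq> grp r m" "same_slice_cards r m I J"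
      "supp r m f \<subseteq> I" "\<forall>y\<in>J. fourier r m \<zeta> f y = 0" for f I J
    using that by (subst sing_iff) blast+
  show "\<exists>I J. I \<subseteq> grp r m \<and> J \<subseteq> grp r m \<and> same_slice_cards r m I J \<and>
      supp r m f \<subseteq> I \<and> (\<forall>y\<in>J. fourier r m \<zeta> f y = 0)"
    if "support_condition r m \<zeta> f" for f
  proof -
    \<comment> \<open>The witness for \<open>I\<close> is the support of \<open>f\<close>
      itself.\<close>
    have "supp r m f \<subseteq> grp r m"
      by (auto simp: supp_def)
    then show ?thesis
      using support_condition_imp_ex_vanishing_set[OF that] by blast
  qed
  show "\<exists>f. (\<exists>x\<in>grp r m. f x \<noteq> 0) \<and> supp r m f \<subseteq> I \<and>
      (\<forall>y\<in>J. fourier r m \<zeta> f y = 0) \<and> support_condition r m \<zeta> f"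
    if IJ: "I \<subseteq> grp r m" "J \<subseteq> grp r m" "same_slice_cards r m I J"
      and sing: "singular_mat (fourier_submatrix r m \<zeta> I J)" for I J
  proof -
    obtain f where "\<exists>x\<in>grp r m. f x \<noteq> 0" "supp r m f \<subseteq> I" "\<forall>y\<in>J. fourier r m \<zeta> f y = 0"
      using sing sing_iff[OF IJ(1,2) IJ] by blast
    then show ?thesis
      using support_condition_if_vanishing[OF IJ(2,3)] by blast
  qed
qed

end
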